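(* For every numerical monoid $H$, the automorphism group $\operatorname{Aut}(\mathcal P_0(H))$ is trivial; that is, the only automorphism of $\mathcal P_0(H)$ is the identity map.
   Context: $\mathbb N$ is the additive monoid of non-negative integers. A numerical monoid is a subset $H \subseteq \mathbb N$ that is closed under addition, has finite complement in $\mathbb N$, and contains $0$. For such $H$, $\mathcal P_0(H)$ denotes the family of all subsets (finite or infinite) of $H$ containing $0$, which is a monoid under the sumset operation $X+Y := \{x+y : x\in X,\ y\in Y\}$, with identity element $\{0\}$. An automorphism is a bijective semigroup homomorphism from the structure to itself. *)

theory Defs
  imports
    "HOL-Algebra.Bij"
    "HOL-Algebra.Elementary_Groups"
    "HOL-Library.Set_Algebras"
begin

definition numerical_monoid :: "nat set \<Rightarrow> bool" where
  "numerical_monoid H \<longleftrightarrow> 0 \<in> H \<and> (\<forall>x\<in>H. \<forall>y\<in>H. x + y \<in> H) \<and> finite (UNIV - H)"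

(* In the mult field, + is the elementwise sum of sets from Set_Algebras. *)
definition reduced_power_monoid :: "nat set \<Rightarrow> nat set monoid" where
  "reduced_power_monoid H =
    \<lparr>carrier = {X. X \<subseteq> H \<and> 0 \<in> X}, mult = (\<lambda>X Y. X + Y), one = {0}\<rparr>"

lemma comm_monoid_reduced_power_monoid:
  assumes "numerical_monoid H"
  shows "comm_monoid (reduced_power_monoid H)"
proof (rule comm_monoidI)
  fix X Y
  assume "X \<in> carrier (reduced_power_monoid H)" "Y \<in> carrier (reduced_power_monoid H)"
  with assms show "X \<otimes>\<^bsub>reduced_power_monoid H\<^esub> Y \<in> carrier (reduced_power_monoid H)"
    by (auto simp: reduced_power_monoid_def numerical_monoid_def set_plus_def)
next
  fix X
  show "\<one>\<^bsub>reduced_power_monoid H\<^esub> \<otimes>\<^bsub>reduced_power_monoid H\<^esub> X = X"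
    by (simp add: reduced_power_monoid_def set_plus_def)
qed (use assms in \<open>auto simp: reduced_power_monoid_def numerical_monoid_def ac_simps\<close>)

end

theory Submission
  imports Defs
begin

text \<open>
  An automorphism \<open>f\<close> of \<open>\<P>\<^sub>0(H)\<close> permutes the idempotents, which are the submonoids of
  \<open>H\<close>. For a submonoid \<open>E\<close>, the inclusion \<open>X \<subseteq> E\<close> says \<open>X + E = E\<close>, so \<open>f\<close> respects inclusions
  into submonoids; in particular it is an automorphism of the lattice of submonoids. The
  proof reads off from this lattice enough to see that \<open>f\<close> fixes every set
  \<open>T\<^sub>n = {0} \<union> {n, n + 1, \<dots>}\<close> contained in \<open>H\<close> with \<open>n > 0\<close>, and then uses these sets as probes.

  The maximal proper submonoids of \<open>E\<close> are the sets \<open>E - {x}\<close> with \<open>x\<close> a minimal generator of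
  \<open>E\<close> (\<open>coatoms_eq_remove_min_gens\<close>), so \<open>f\<close> preserves the number of minimal generators
  (\<open>card_min_gens_f\<close>). Minimal generators are pairwise incongruent modulo any positive element
  of \<open>E\<close>, so their number is at most the least such element (\<open>card_min_gens_le\<close>), whereas
  \<open>T\<^sub>n\<close> has the \<open>n\<close> minimal generators \<open>n, \<dots>, 2n - 1\<close>. Hence no positive element of \<open>f T\<^sub>n\<close> is
  below \<open>n\<close>, that is, \<open>f T\<^sub>n \<subseteq> T\<^sub>n\<close>; the inverse of \<open>f\<close> gives equality (\<open>f_tail\<close>).

  Adding \<open>T\<^sub>n\<close> to \<open>X\<close> yields \<open>X \<union> {n, n + 1, \<dots>}\<close>, so \<open>f\<close> commutes with this operation. As \<open>n \<in> X\<close>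
  holds exactly if the operation gives the same result for \<open>n\<close> and for \<open>n + 1\<close>, the sets \<open>X\<close>
  and \<open>f X\<close> have the same elements from the conductor of \<open>H\<close> on (\<open>mem_f_iff_of_large\<close>). To see
  the elements below a bound \<open>c\<close> past the conductor, shift them into the visible range: for
  \<open>X \<subseteq> {0, \<dots>, c - 1}\<close>, the part of \<open>X + {0, c}\<close> from \<open>c\<close> on is \<open>c + X\<close>, and \<open>f\<close> fixes \<open>{0, c}\<close>;
  so \<open>f X = X\<close> (\<open>f_eq_below\<close>). Truncation at \<open>c\<close> reduces an arbitrary \<open>X\<close> to these two cases.
\<close>

section \<open>Submonoids and their minimal generators\<close>

definition submonoids :: "nat set \<Rightarrow> nat set set" where
  "submonoids H = {E. E \<subseteq> H \<and> 0 \<in> E \<and> (\<forall>x\<in>E. \<forall>y\<in>E. x + y \<in> E)}"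

definition coatoms :: "nat set \<Rightarrow> nat set \<Rightarrow> nat set set" where
  "coatoms H E = {D \<in> submonoids H. D \<subset> E \<and> (\<forall>F \<in> submonoids H. D \<subset> F \<longrightarrow> F \<subseteq> E \<longrightarrow> F = E)}"

text \<open>
  Sums of two suffice here: in a submonoid, splitting off one summand turns any longer sum of
  positive elements into a sum of two smaller elements.
\<close>

definition min_gens :: "nat set \<Rightarrow> nat set" where
  "min_gens E = {x \<in> E. x \<noteq> 0 \<and> (\<forall>y\<in>E - {x}. \<forall>z\<in>E - {x}. y + z \<noteq> x)}"

text \<open>
  This expresses inclusion in a submonoid through addition alone, hence in a form that every
  automorphism preserves.
\<close>

lemma submonoids_plus_eq_iff:
  assumes "E \<in> submonoids H" "0 \<in> X"
  shows "X + E = E \<longleftrightarrow> X \<subseteq> E"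
proof
  assume eq: "X + E = E"
  have "x + 0 \<in> X + E" if "x \<in> X" for x
    using that assms(1) by (intro set_plus_intro) (simp_all add: submonoids_def)
  then show "X \<subseteq> E" unfolding eq by auto
next
  assume "X \<subseteq> E"
  then have "X + E \<subseteq> E"
    using assms(1) by (auto simp: submonoids_def elim!: set_plus_elim)
  then show "X + E = E"
    using set_zero_plus2[OF assms(2), of E] by blast
qed

lemma submonoids_iff_idempotent:
  "E \<in> submonoids H \<longleftrightarrow> E \<subseteq> H \<and> 0 \<in> E \<and> E + E = E"
proof
  assume "E \<in> submonoids H"
  with submonoids_plus_eq_iff[OF this] show "E \<subseteq> H \<and> 0 \<in> E \<and> E + E = E"
    by (simp add: submonoids_def)
next
  assume E: "E \<subseteq> H \<and> 0 \<in> E \<and> E + E = E"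
  have "x + y \<in> E + E" if "x \<in> E" "y \<in> E" for x y
    using that by (rule set_plus_intro)
  with E show "E \<in> submonoids H"
    by (simp add: submonoids_def)
qed

lemma remove_submonoid_iff:
  assumes E: "E \<in> submonoids H" "x \<in> E"
  shows "E - {x} \<in> submonoids H \<longleftrightarrow> x \<in> min_gens E"
proof
  assume D: "E - {x} \<in> submonoids H"
  then have "x \<noteq> 0" and "\<And>y z. y \<in> E - {x} \<Longrightarrow> z \<in> E - {x} \<Longrightarrow> y + z \<in> E - {x}"
    by (simp_all add: submonoids_def)
  with E(2) show "x \<in> min_gens E" unfolding min_gens_def by blast
next
  assume x: "x \<in> min_gens E"
  then have "x \<noteq> 0" and "\<And>y z. y \<in> E - {x} \<Longrightarrow> z \<in> E - {x} \<Longrightarrow> y + z \<noteq> x"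
    unfolding min_gens_def by blast+
  then show "E - {x} \<in> submonoids H"
    using E(1) by (auto simp: submonoids_def)
qed

text \<open>
  If \<open>D\<close> is a submonoid of \<open>E\<close> and \<open>x \<in> E - D\<close>, then \<open>D\<close> together with all elements of \<open>E\<close> above
  \<open>x\<close> is a submonoid between \<open>D\<close> and \<open>E\<close> that misses \<open>x\<close>. When \<open>D\<close> is maximal, this submonoid
  must be \<open>D\<close> itself, so every element of \<open>E - D\<close> is the largest one and only one can exist.
\<close>

lemma coatoms_eq_remove_min_gens:
  assumes E: "E \<in> submonoids H"
  shows "coatoms H E = (\<lambda>x. E - {x}) ` min_gens E"
proof (intro equalityI subsetI)
  fix D assume "D \<in> coatoms H E"
  then have D: "D \<in> submonoids H" "D \<subset> E"
    and max: "\<And>F. F \<in> submonoids H \<Longrightarrow> D \<subset> F \<Longrightarrow> F \<subseteq> E \<Longrightarrow> F = E"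
    by (auto simp: coatoms_def)
  have above: "y \<le> x" if x: "x \<in> E - D" and y: "y \<in> E - D" for x y
  proof (rule ccontr)
    assume "\<not> y \<le> x"
    let ?F = "D \<union> {z \<in> E. x < z}"
    have "u + v \<in> ?F" if "u \<in> ?F" "v \<in> ?F" for u v
    proof -
      have "u \<in> E" "v \<in> E" using that D(2) by blast+
      then have "u + v \<in> E" using E by (simp add: submonoids_def)
      moreover have "u + v \<in> D \<or> x < u + v" using that D by (auto simp: submonoids_def)
      ultimately show ?thesis by blast
    qed
    moreover have "?F \<subseteq> H" "0 \<in> ?F"
      using D(1) E by (auto simp: submonoids_def)
    ultimately have "?F \<in> submonoids H"
      unfolding submonoids_def by blast
    moreover have "D \<subset> ?F" "?F \<subseteq> E"
      using D y \<open>\<not> y \<le> x\<close> by auto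
    ultimately have "?F = E" by (rule max)
    then show False using x by blast
  qed
  obtain x where x: "x \<in> E - D" using D by auto
  have "y = x" if "y \<in> E - D" for y
    using above[OF x that] above[OF that x] by simp
  then have D_eq: "D = E - {x}" using x D(2) by blast
  with D(1) x remove_submonoid_iff[OF E, of x] show "D \<in> (\<lambda>x. E - {x}) ` min_gens E"
    by simp
next
  fix D assume "D \<in> (\<lambda>x. E - {x}) ` min_gens E"
  then obtain x where x: "x \<in> min_gens E" "x \<in> E" and D: "D = E - {x}"
    by (auto simp: min_gens_def)
  have "D \<in> submonoids H" using remove_submonoid_iff[OF E x(2)] x(1) D by simp
  moreover have "D \<subset> E" using x(2) D by blast
  moreover have "F = E" if "D \<subset> F" "F \<subseteq> E" for F
    using that D by blast
  ultimately show "D \<in> coatoms H E" by (simp add: coatoms_def)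
qed

lemma inj_on_remove_min_gen: "inj_on (\<lambda>x. E - {x}) (min_gens E)"
  by (rule inj_onI) (auto simp: min_gens_def)

text \<open>
  Of two congruent elements \<open>x < y\<close> modulo \<open>m\<close>, the larger one is the sum of \<open>y - m\<close> and \<open>m\<close>, both
  in \<open>E\<close>, so it is not a minimal generator unless \<open>x = 0\<close>. Hence the minimal generators have
  distinct residues.
\<close>

lemma card_min_gens_le:
  assumes E: "E \<in> submonoids H" and m: "m \<in> E" "m > 0"
  shows "finite (min_gens E) \<and> card (min_gens E) \<le> m"
proof -
  have mult: "x + k * m \<in> E" if "x \<in> E" for x k
  proof (induction k)
    case (Suc k)
    then have "(x + k * m) + m \<in> E" using E m by (simp add: submonoids_def)
    then show ?case by (simp add: algebra_simps)
  qed (use that in simp)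
  have no_shift: False
    if x: "x \<in> min_gens E" and y: "y \<in> min_gens E" and less: "x < y" and cong: "x mod m = y mod m"
    for x y
  proof -
    obtain k where k: "y = x + k * m"
      using mod_eq_nat1E[OF cong[symmetric] less_imp_le[OF less]] by (metis mult.commute)
    with \<open>x < y\<close> obtain j where "k = Suc j" by (cases k) auto
    with k have y_eq: "y = (x + j * m) + m" by simp
    have xy: "x \<in> E" "x \<noteq> 0" using x by (simp_all add: min_gens_def)
    have "x + j * m \<in> E - {y}" "m \<in> E - {y}"
      using mult[OF xy(1), of j] xy(2) m y_eq by simp_all
    with y y_eq show False unfolding min_gens_def by blast
  qed
  have inj: "inj_on (\<lambda>x. x mod m) (min_gens E)"
  proof (rule inj_onI)
    fix x y assume "x \<in> min_gens E" "y \<in> min_gens E" "x mod m = y mod m"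
    with no_shift[of x y] no_shift[of y x] show "x = y"
      by (cases x y rule: linorder_cases) simp_all
  qed
  have into: "(\<lambda>x. x mod m) ` min_gens E \<subseteq> {..<m}"
    using m(2) by auto
  show ?thesis
    using inj_on_finite[OF inj into] card_inj_on_le[OF inj into] by simp
qed

section \<open>The submonoids that omit an initial segment\<close>

definition tail :: "nat \<Rightarrow> nat set" where
  "tail n = insert 0 {n..}"

lemma plus_tail:
  assumes "0 \<in> X"
  shows "X + tail n = X \<union> {n..}"
proof -
  have "X + {n..} \<subseteq> {n..}" by (auto elim!: set_plus_elim)
  moreover have "{n..} \<subseteq> X + {n..}" by (rule set_zero_plus2[OF assms])
  ultimately show ?thesis by (auto simp: tail_def set_plus_insert)
qed

lemma tail_in_submonoids: "{n..} \<subseteq> H \<Longrightarrow> 0 \<in> H \<Longrightarrow> tail n \<in> submonoids H"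
  by (auto simp: tail_def submonoids_def)

text \<open>
  The sum of two nonzero elements of \<open>tail n\<close> is at least \<open>2 * n\<close>. By \<open>card_min_gens_le\<close>, the
  number of minimal generators is as large as the smallest nonzero element permits.
\<close>

lemma min_gens_tail: "n > 0 \<Longrightarrow> {n..<2 * n} \<subseteq> min_gens (tail n)"
  by (fastforce simp: tail_def min_gens_def)

section \<open>The action of an automorphism on submonoids\<close>

locale power_monoid_automorphism =
  fixes H :: "nat set" and f :: "nat set \<Rightarrow> nat set"
  assumes zero_in: "0 \<in> H"
    and closed: "x \<in> H \<Longrightarrow> y \<in> H \<Longrightarrow> x + y \<in> H"
    and bij: "bij_betw f {X. X \<subseteq> H \<and> 0 \<in> X} {X. X \<subseteq> H \<and> 0 \<in> X}"
    and add: "X \<subseteq> H \<Longrightarrow> 0 \<in> X \<Longrightarrow> Y \<subseteq> H \<Longrightarrow> 0 \<in> Y \<Longrightarrow> f (X + Y) = f X + f Y"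
begin

abbreviation (input) P where "P \<equiv> {X. X \<subseteq> H \<and> 0 \<in> X}"

lemma f_in:
  assumes "X \<subseteq> H" "0 \<in> X"
  shows "f X \<subseteq> H" "0 \<in> f X"
  using bij_betw_apply[OF bij, of X] assms by simp_all

lemma f_eq_iff: "X \<subseteq> H \<Longrightarrow> 0 \<in> X \<Longrightarrow> Y \<subseteq> H \<Longrightarrow> 0 \<in> Y \<Longrightarrow> f X = f Y \<longleftrightarrow> X = Y"
  by (intro inj_on_eq_iff[OF bij_betw_imp_inj_on[OF bij]]) simp_all

lemma plus_in:
  assumes "X \<subseteq> H" "0 \<in> X" "Y \<subseteq> H" "0 \<in> Y"
  shows "X + Y \<subseteq> H" "0 \<in> X + Y"
proof -
  show "X + Y \<subseteq> H"
    using assms closed by (auto elim!: set_plus_elim)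
  show "0 \<in> X + Y"
    using set_plus_intro[OF assms(2,4)] by simp
qed

text \<open>
  An inclusion \<open>f E \<subseteq> E\<close> of submonoids that is proved for all automorphisms \<open>f\<close> holds for the
  inverse as well, and so becomes an equality.
\<close>

lemma inverse_automorphism: "power_monoid_automorphism H (inv_into P f)"
proof
  let ?g = "inv_into P f"
  show bij_g: "bij_betw ?g P P" by (rule bij_betw_inv_into[OF bij])
  fix X Y assume X: "X \<subseteq> H" "0 \<in> X" and Y: "Y \<subseteq> H" "0 \<in> Y"
  have g: "?g X \<subseteq> H" "0 \<in> ?g X" "?g Y \<subseteq> H" "0 \<in> ?g Y"
    using bij_betw_apply[OF bij_g, of X] bij_betw_apply[OF bij_g, of Y] X Y by simp_all
  have "f (?g X) = X" "f (?g Y) = Y"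
    using X Y by (simp_all add: bij_betw_inv_into_right[OF bij])
  then have "f (?g X + ?g Y) = X + Y"
    by (simp add: add[OF g])
  moreover have "?g (f (?g X + ?g Y)) = ?g X + ?g Y"
    using plus_in[OF g] by (intro bij_betw_inv_into_left[OF bij]) simp
  ultimately show "?g (X + Y) = ?g X + ?g Y" by simp
qed (use zero_in closed in auto)

lemma f_submonoid:
  assumes X: "X \<subseteq> H" "0 \<in> X"
  shows "f X \<in> submonoids H \<longleftrightarrow> X \<in> submonoids H"
proof -
  have "f X \<in> submonoids H \<longleftrightarrow> f (X + X) = f X"
    using f_in[OF X] by (simp add: submonoids_iff_idempotent add[OF X X])
  also have "\<dots> \<longleftrightarrow> X + X = X"
    by (rule f_eq_iff[OF plus_in[OF X X] X])
  finally show ?thesis using X by (simp add: submonoids_iff_idempotent)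
qed

lemma f_mono_iff:
  assumes X: "X \<subseteq> H" "0 \<in> X" and E: "E \<in> submonoids H"
  shows "f X \<subseteq> f E \<longleftrightarrow> X \<subseteq> E"
proof -
  have E': "E \<subseteq> H" "0 \<in> E" using E by (simp_all add: submonoids_def)
  have fE: "f E \<in> submonoids H" using f_submonoid[OF E'] E by simp
  have "f X \<subseteq> f E \<longleftrightarrow> f X + f E = f E"
    by (rule submonoids_plus_eq_iff[OF fE f_in(2)[OF X], symmetric])
  also have "\<dots> \<longleftrightarrow> f (X + E) = f E"
    by (simp add: add[OF X E'])
  also have "\<dots> \<longleftrightarrow> X + E = E"
    by (rule f_eq_iff[OF plus_in[OF X E'] E'])
  also have "\<dots> \<longleftrightarrow> X \<subseteq> E" by (rule submonoids_plus_eq_iff[OF E X(2)])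
  finally show ?thesis .
qed

lemma image_submonoids: "f ` submonoids H = submonoids H"
proof (intro equalityI subsetI)
  fix E assume "E \<in> f ` submonoids H"
  then obtain D where D: "D \<in> submonoids H" "E = f D" by blast
  then have "D \<subseteq> H" "0 \<in> D" by (simp_all add: submonoids_def)
  with D f_submonoid[of D] show "E \<in> submonoids H" by simp
next
  fix E assume E: "E \<in> submonoids H"
  then have "E \<in> f ` P"
    using bij_betw_imp_surj_on[OF bij] by (simp add: submonoids_def)
  then obtain D where D: "D \<subseteq> H" "0 \<in> D" "E = f D" by auto
  with E f_submonoid[of D] show "E \<in> f ` submonoids H" by simp
qed

lemma f_psubset_iff:
  assumes "D \<in> submonoids H" "E \<in> submonoids H"
  shows "f D \<subset> f E \<longleftrightarrow> D \<subset> E"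
proof -
  have "D \<subseteq> H" "0 \<in> D" "E \<subseteq> H" "0 \<in> E"
    using assms by (simp_all add: submonoids_def)
  with assms f_mono_iff[of D E] f_mono_iff[of E D] show ?thesis
    by (simp add: less_le_not_le)
qed

lemma image_coatoms:
  assumes E: "E \<in> submonoids H"
  shows "f ` coatoms H E = coatoms H (f E)"
proof -
  have "f D \<in> coatoms H (f E) \<longleftrightarrow> D \<in> coatoms H E" if D: "D \<in> submonoids H" for D
  proof -
    have eq: "f F = f E \<longleftrightarrow> F = E" if "F \<in> submonoids H" for F
      using that E f_eq_iff by (simp add: submonoids_def)
    have sub: "f F \<subseteq> f E \<longleftrightarrow> F \<subseteq> E" if "F \<in> submonoids H" for F
      using that E f_mono_iff by (simp add: submonoids_def)
    have "f D \<in> coatoms H (f E) \<longleftrightarrow> f D \<in> f ` submonoids H \<and> f D \<subset> f E \<and>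
        (\<forall>F \<in> f ` submonoids H. f D \<subset> F \<longrightarrow> F \<subseteq> f E \<longrightarrow> F = f E)"
      by (simp add: coatoms_def image_submonoids)
    also have "\<dots> \<longleftrightarrow> D \<subset> E \<and> (\<forall>F \<in> submonoids H. D \<subset> F \<longrightarrow> F \<subseteq> E \<longrightarrow> F = E)"
      using D E by (simp add: f_psubset_iff sub eq)
    finally show ?thesis using D by (simp add: coatoms_def)
  qed
  moreover have "coatoms H E \<subseteq> submonoids H" "coatoms H (f E) \<subseteq> f ` submonoids H"
    by (auto simp: coatoms_def image_submonoids)
  ultimately show ?thesis by blast
qed

text \<open>
  The coatoms of a submonoid are determined by the order and correspond to its minimal generators.
\<close>

lemma card_min_gens_f:
  assumes E: "E \<in> submonoids H"
  shows "card (min_gens (f E)) = card (min_gens E)"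
proof -
  have fE: "f E \<in> submonoids H" using E image_submonoids by blast
  have card: "card (coatoms H D) = card (min_gens D)" if "D \<in> submonoids H" for D
    by (simp add: coatoms_eq_remove_min_gens[OF that] card_image inj_on_remove_min_gen)
  have "coatoms H E \<subseteq> P"
    unfolding coatoms_def submonoids_def by blast
  then have "inj_on f (coatoms H E)"
    by (rule inj_on_subset[OF bij_betw_imp_inj_on[OF bij]])
  then have "card (coatoms H (f E)) = card (coatoms H E)"
    unfolding image_coatoms[OF E, symmetric] by (rule card_image)
  then show ?thesis by (simp add: card E fE)
qed

section \<open>The automorphism fixes the tails\<close>

text \<open>
  A positive element \<open>m\<close> of \<open>f (tail n)\<close> bounds the number of minimal generators of
  \<open>f (tail n)\<close>, and this number is the one of \<open>tail n\<close>, hence at least \<open>n\<close>.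
\<close>

lemma f_tail_subset:
  assumes n: "n > 0" "{n..} \<subseteq> H"
  shows "f (tail n) \<subseteq> tail n"
proof -
  have T: "tail n \<in> submonoids H" by (rule tail_in_submonoids[OF n(2) zero_in])
  have fT: "f (tail n) \<in> submonoids H" using T image_submonoids by blast
  have "n \<in> tail n" by (simp add: tail_def)
  then have "finite (min_gens (tail n))"
    using card_min_gens_le[OF T] n(1) by blast
  from card_mono[OF this min_gens_tail[OF n(1)]]
  have many: "n \<le> card (min_gens (f (tail n)))"
    by (simp add: card_min_gens_f[OF T])
  show ?thesis
  proof
    fix m assume m: "m \<in> f (tail n)"
    show "m \<in> tail n"
      using card_min_gens_le[OF fT m] many by (cases "m = 0") (auto simp: tail_def)
  qed
qed

lemma f_tail:
  assumes n: "n > 0" "{n..} \<subseteq> H"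
  shows "f (tail n) = tail n"
proof
  show "f (tail n) \<subseteq> tail n" by (rule f_tail_subset[OF n])
  interpret inv: power_monoid_automorphism H "inv_into P f" by (rule inverse_automorphism)
  have T: "tail n \<in> submonoids H" by (rule tail_in_submonoids[OF n(2) zero_in])
  then have T': "tail n \<subseteq> H" "0 \<in> tail n" by (simp_all add: submonoids_def)
  have "f (inv_into P f (tail n)) \<subseteq> f (tail n)"
    using inv.f_tail_subset[OF n] f_mono_iff[OF inv.f_in[OF T'] T] by simp
  then show "tail n \<subseteq> f (tail n)"
    using T' by (simp add: bij_betw_inv_into_right[OF bij])
qed

section \<open>The automorphism is the identity\<close>

lemma f_Un_atLeast:
  assumes n: "n > 0" "{n..} \<subseteq> H" and X: "X \<subseteq> H" "0 \<in> X"
  shows "f (X \<union> {n..}) = f X \<union> {n..}"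
proof -
  have "tail n \<subseteq> H" "0 \<in> tail n" using n zero_in by (auto simp: tail_def)
  from add[OF X this] show ?thesis
    by (simp add: plus_tail X(2) f_in(2)[OF X] f_tail[OF n])
qed

text \<open>
  Membership of \<open>n\<close> in \<open>X\<close> is the equation \<open>X \<union> {n..} = X \<union> {Suc n..}\<close>, which \<open>f\<close> preserves
  and, being injective, also reflects.
\<close>

lemma mem_f_iff_of_large:
  assumes n: "n > 0" "{n..} \<subseteq> H" and X: "X \<subseteq> H" "0 \<in> X"
  shows "n \<in> f X \<longleftrightarrow> n \<in> X"
proof -
  have split: "{n..} = insert n {Suc n..}" by auto
  have mem: "n \<in> Y \<longleftrightarrow> Y \<union> {n..} = Y \<union> {Suc n..}" for Y
    unfolding split by auto
  have n': "{Suc n..} \<subseteq> H" using n by auto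
  have "n \<in> f X \<longleftrightarrow> f (X \<union> {n..}) = f (X \<union> {Suc n..})"
    using f_Un_atLeast[OF n X] f_Un_atLeast[OF _ n' X] mem by simp
  also have "\<dots> \<longleftrightarrow> X \<union> {n..} = X \<union> {Suc n..}"
    using n n' X by (intro f_eq_iff) auto
  finally show ?thesis by (simp add: mem)
qed

text \<open>
  Membership from \<open>c\<close> on is already controlled. Adding \<open>{0, c}\<close> copies the elements of \<open>X\<close>, all
  below \<open>c\<close>, to places from \<open>c\<close> on, and no element of \<open>X\<close> interferes there.
\<close>

lemma f_eq_below:
  assumes c: "c > 0" "{c..} \<subseteq> H" and X: "X \<subseteq> H" "0 \<in> X" "X \<subseteq> {..<c}"
  shows "f X = X"
proof -
  have large: "y \<in> f Y \<longleftrightarrow> y \<in> Y" if "Y \<subseteq> H" "0 \<in> Y" "c \<le> y" for y Y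
    using that c by (intro mem_f_iff_of_large) auto
  have pair: "{0, c} \<subseteq> H" using c zero_in by auto
  \<comment> \<open>Filling up with \<open>{c..}\<close> turns \<open>{0, c}\<close> into the fixed set \<open>tail c\<close>, so \<open>f {0, c}\<close> gains
    no element below \<open>c\<close> other than \<open>0\<close>.\<close>
  have f_pair: "f {0, c} = {0, c}"
  proof -
    have "f {0, c} \<union> {c..} = f ({0, c} \<union> {c..})"
      using f_Un_atLeast[OF c pair] by simp
    also have "{0, c} \<union> {c..} = tail c" by (auto simp: tail_def)
    finally have below: "f {0, c} \<union> {c..} = insert 0 {c..}"
      using f_tail[OF c] by (simp add: tail_def)
    have "y \<in> f {0, c} \<longleftrightarrow> y \<in> {0, c}" for y
    proof (cases "c \<le> y")
      case True
      then show ?thesis using large[OF pair] by simp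
    next
      case False
      then have "y \<in> f {0, c} \<longleftrightarrow> y \<in> f {0, c} \<union> {c..}" by simp
      then show ?thesis using False unfolding below by auto
    qed
    then show ?thesis by blast
  qed
  have shift: "x \<in> Y \<longleftrightarrow> x + c \<in> Y + {0, c}" if "Y \<subseteq> {..<c}" for x and Y :: "nat set"
  proof -
    have "Y + {0, c} = Y \<union> (\<lambda>y. y + c) ` Y"
      by (auto simp: set_plus_def)
    with that show ?thesis by auto
  qed
  have "f X \<subseteq> {..<c}"
  proof
    fix y assume "y \<in> f X"
    then show "y \<in> {..<c}" using large[of X y] X by (cases "c \<le> y") auto
  qed
  then have "x \<in> f X \<longleftrightarrow> x + c \<in> f (X + {0, c})" for x
    using X pair by (simp add: shift add f_pair)
  also have "x + c \<in> f (X + {0, c}) \<longleftrightarrow> x + c \<in> X + {0, c}" for x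
    using X pair plus_in[of X "{0, c}"] by (intro large) auto
  finally show ?thesis using shift[OF X(3)] by blast
qed

lemma f_eq_self:
  assumes H: "finite (UNIV - H)" and X: "X \<subseteq> H" "0 \<in> X"
  shows "f X = X"
proof -
  obtain b where b: "\<And>x. x \<notin> H \<Longrightarrow> x < b"
    using H unfolding finite_nat_set_iff_bounded by auto
  \<comment> \<open>The successor makes the bound positive, also for \<open>H = UNIV\<close>.\<close>
  define c where "c = Suc b"
  have c: "c > 0" "{c..} \<subseteq> H" using b by (force simp: c_def)+
  let ?Y = "X \<inter> {..<c}"
  have Y: "?Y \<subseteq> H" "0 \<in> ?Y" using X c by auto
  have "X \<union> {c..} = ?Y \<union> {c..}" by auto
  then have trunc: "f X \<union> {c..} = ?Y \<union> {c..}"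
    using f_Un_atLeast[OF c X] f_Un_atLeast[OF c Y] f_eq_below[OF c Y] by simp
  have "x \<in> f X \<longleftrightarrow> x \<in> X" for x
  proof (cases "c \<le> x")
    case True
    then show ?thesis using c X by (intro mem_f_iff_of_large) auto
  next
    case False
    then have "x \<in> f X \<longleftrightarrow> x \<in> f X \<union> {c..}" by simp
    then show ?thesis using False unfolding trunc by simp
  qed
  then show ?thesis by blast
qed

end

theorem theorem3p3:
  fixes H :: "nat set"
  assumes "numerical_monoid H"
  shows "trivial_group (AutoGroup (reduced_power_monoid H)) \<and>
    (\<forall>f \<in> iso (reduced_power_monoid H) (reduced_power_monoid H).
       \<forall>X \<in> carrier (reduced_power_monoid H). f X = X)"
proof
  let ?M = "reduced_power_monoid H"
  show fixed: "\<forall>f \<in> iso ?M ?M. \<forall>X \<in> carrier ?M. f X = X"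
  proof (intro ballI)
    fix f X assume f: "f \<in> iso ?M ?M" and X: "X \<in> carrier ?M"
    interpret power_monoid_automorphism H f
      using assms f
      by unfold_locales (auto simp: numerical_monoid_def reduced_power_monoid_def iso_def hom_def)
    show "f X = X"
      using assms X by (intro f_eq_self) (auto simp: numerical_monoid_def reduced_power_monoid_def)
  qed
  interpret comm_monoid ?M by (rule comm_monoid_reduced_power_monoid[OF assms])
  let ?id = "\<lambda>X \<in> carrier ?M. X"
  have "auto ?M = {?id}"
  proof
    show "{?id} \<subseteq> auto ?M"
      by (simp add: auto_def hom_def id_Bij)
    show "auto ?M \<subseteq> {?id}"
    proof
      fix f assume f: "f \<in> auto ?M"
      then have "f \<in> iso ?M ?M" by (simp add: auto_def iso_def Bij_def)
      with fixed have "\<And>X. X \<in> carrier ?M \<Longrightarrow> f X = X" by blast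
      moreover have "f \<in> extensional (carrier ?M)" using f by (simp add: auto_def Bij_def)
      ultimately show "f \<in> {?id}" by (auto intro: extensionalityI)
    qed
  qed
  then have auto_eq: "auto ?M = {\<one>\<^bsub>BijGroup (carrier ?M)\<^esub>}"
    by (simp add: BijGroup_def)
  have "group (AutoGroup ?M)"
    unfolding AutoGroup_def auto_eq
    by (intro subgroup.subgroup_is_group group.triv_subgroup group_BijGroup)
  then show "trivial_group (AutoGroup ?M)"
    by (simp add: trivial_group_def AutoGroup_def auto_eq)
qed

end
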